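(* Let $X$ and $Y$ be metric spaces and let $E$ and $F$ be nontrivial normed spaces. A map $T:C(X,E)\to C(Y,F)$ is a biseparating map if and only if there are a homeomorphism $\varphi:X\to Y$ and functions $\Phi:Y\times E\to F$, $\Psi:X\times F\to E$ such that $(Tf)(y)=\Phi(y,f(\varphi^{-1}(y)))$ for all $f\in C(X,E)$ and $y\in Y$, and (1) $\Phi(y,\cdot)$ and $\Psi(x,\cdot)$ are mutual inverses if $\varphi(x)=y$; (2) $\Phi$ is continuous at any point in $Y'\times E$; $\Psi$ is continuous at any point in $X'\times F$.
   Context: $C(X,E)$ is the space of continuous functions $X\to E$. $X'$ and $Y'$ denote the sets of accumulation points of $X$ and $Y$. For a function $f$ let $C(f)=\{x: f(x)\neq 0\}$, and for functions $f,g,h$ in the same space write $f\perp_h g$ if $C(f-h)\cap C(g-h)=\emptyset$. A map $T$ (not assumed linear) between two function spaces is biseparating if it is a bijection and for all $f,g,h$ in its domain: $f\perp_h g\iff Tf\perp_{Th}Tg$. *)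

theory Defs
  imports "HOL-Analysis.Analysis"
begin

text \<open>
  A metric space is rendered as an arbitrary subset \<open>X\<close> of a type of class
  \<^class>\<open>metric_space\<close> with the induced metric, so that the empty space is included.
  A function on \<open>X\<close> is a function in \<^term>\<open>extensional X\<close>: its values outside \<open>X\<close> are
  fixed to be \<^term>\<open>undefined\<close>, so equality of such functions is equality on \<open>X\<close>.
\<close>

definition cfuns :: "'a::metric_space set \<Rightarrow> ('a \<Rightarrow> 'e::real_normed_vector) set" where
  "cfuns X = {f \<in> extensional X. continuous_on X f}"

definition accumulation_points :: "'a::metric_space set \<Rightarrow> 'a set" where
  "accumulation_points X = {x \<in> X. x islimpt X}"

definition cozero :: "'a set \<Rightarrow> ('a \<Rightarrow> 'e::real_normed_vector) \<Rightarrow> 'a set" where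
  "cozero X f = {x \<in> X. f x \<noteq> 0}"

definition perp ::
  "'a set \<Rightarrow> ('a \<Rightarrow> 'e::real_normed_vector) \<Rightarrow> ('a \<Rightarrow> 'e) \<Rightarrow> ('a \<Rightarrow> 'e) \<Rightarrow> bool" where
  "perp X h f g \<longleftrightarrow> cozero X (\<lambda>x. f x - h x) \<inter> cozero X (\<lambda>x. g x - h x) = {}"

definition biseparating ::
  "'a::metric_space set \<Rightarrow> 'b::metric_space set \<Rightarrow>
    (('a \<Rightarrow> 'e::real_normed_vector) \<Rightarrow> ('b \<Rightarrow> 'f::real_normed_vector)) \<Rightarrow> bool" where
  "biseparating X Y T \<longleftrightarrow>
    bij_betw T (cfuns X) (cfuns Y) \<and>
    (\<forall>f\<in>cfuns X. \<forall>g\<in>cfuns X. \<forall>h\<in>cfuns X. perp X h f g \<longleftrightarrow> perp Y (T h) (T f) (T g))"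

end

theory Submission
  imports Defs
begin

text \<open>
  The easy direction writes the preimage of \<open>g\<close> as \<open>x \<mapsto> \<Psi> (x, g (\<phi> x))\<close>, which is
  continuous at accumulation points because \<open>\<Psi>\<close> is, and at isolated points trivially.

  For the converse, the difficulty is that the relation of \<open>f\<close> and \<open>g\<close> being disjoint refers to a
  base function \<open>h\<close>, and nonlinearity prevents translating every base to \<open>0\<close>.  The key is a
  separation lemma that compares two different bases: if the closures of \<open>{f \<noteq> g}\<close> and
  \<open>{h \<noteq> k}\<close> do not meet, then \<open>{T f \<noteq> T g}\<close> and \<open>{T h \<noteq> T k}\<close> do not meet.  It follows by gluing
  \<open>g\<close>, respectively \<open>f\<close>, to \<open>k\<close> and using the two glued functions as witnesses of disjointness
  (lemma \<open>separation\<close>).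

  Points are recovered by a relation \<open>linked x y\<close>, symmetric in \<open>T\<close> and its inverse: agreement of
  two functions near \<open>x\<close> forces agreement of their images at \<open>y\<close>, and agreement of the images near
  \<open>y\<close> forces agreement of the functions at \<open>x\<close>.  A point is linked to at most one other point,
  since functions can be glued.  It is linked to at least one: fix \<open>y\<close>, perturb \<open>T h\<close> on shrinking
  balls around \<open>y\<close> and let \<open>C n\<close> be the set where the preimage differs from \<open>h\<close>.  If the closures of
  the \<open>C n\<close> had no common point, a selection of points from them would form an infinite closed
  discrete set; a function equal to \<open>p\<close> near infinitely many of these points and to \<open>q\<close> near
  infinitely many others would have an image that equals \<open>T p\<close> and \<open>T q\<close> at \<open>y\<close>, for
  arbitrary \<open>p\<close> and \<open>q\<close> (lemma \<open>linked_ex_left\<close>).  So \<open>linked\<close> is the graph of a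
  bijection; gluing once more shows that it is a homeomorphism.

  If \<open>f x = g x\<close>, then a function equal to \<open>f\<close> near every other term of an injective sequence
  tending to \<open>x\<close> and to \<open>g\<close> near the remaining terms shows that \<open>T f\<close> and \<open>T g\<close> agree at the point
  linked to \<open>x\<close> (lemma \<open>T_local\<close>).  Hence \<open>\<Phi> (y, u)\<close> can be defined as the value at \<open>y\<close> of the image
  of the constant function \<open>u\<close>.  A failure of continuity at an accumulation point can be moved to a
  sequence of distinct points \<open>x n\<close> with values \<open>e n\<close> such that a single continuous function takes all
  these values (lemma \<open>exists_function_through_sequence\<close>); the continuity of its image is then
  contradicted.
\<close>

section \<open>Continuous functions and the sets on which they differ\<close>

definition differ :: "'a set \<Rightarrow> ('a \<Rightarrow> 'e) \<Rightarrow> ('a \<Rightarrow> 'e) \<Rightarrow> 'a set" where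
  "differ X f g = {x \<in> X. f x \<noteq> g x}"

lemma differ_commute: "differ X f g = differ X g f"
  by (auto simp: differ_def)

lemma perp_iff_differ: "perp X h f g \<longleftrightarrow> differ X f h \<inter> differ X g h = {}"
  by (auto simp: perp_def cozero_def differ_def)

lemma cfunsD: "f \<in> cfuns X \<Longrightarrow> continuous_on X f"
  by (simp add: cfuns_def)

lemma restrict_cfuns: "continuous_on X f \<Longrightarrow> restrict f X \<in> cfuns X"
  unfolding cfuns_def by (auto intro: continuous_on_eq)

lemma restrict_const_cfuns: "(\<lambda>x\<in>X. e) \<in> cfuns X"
  by (simp add: restrict_cfuns)

lemma cfuns_eqI:
  assumes "f \<in> cfuns X" "g \<in> cfuns X" "\<And>x. x \<in> X \<Longrightarrow> f x = g x"
  shows "f = g"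
  using assms by (auto simp: cfuns_def intro: extensionalityI)

lemma differ_open:
  assumes f: "f \<in> cfuns X" and g: "g \<in> cfuns X" and x: "x \<in> differ X f g"
  shows "\<exists>r>0. X \<inter> ball x r \<subseteq> differ X f g"
proof -
  have "continuous (at x within X) (\<lambda>z. dist (f z) (g z))"
    using f g x by (intro continuous_intros) (auto simp: cfuns_def differ_def continuous_on_eq_continuous_within)
  moreover have pos: "dist (f x) (g x) > 0"
    using x by (simp add: differ_def)
  ultimately obtain r where "r > 0"
    and r: "\<And>z. \<lbrakk>z \<in> X; dist z x < r\<rbrakk> \<Longrightarrow> dist (dist (f z) (g z)) (dist (f x) (g x)) < dist (f x) (g x)"
    unfolding continuous_within_eps_delta by metis
  have "z \<in> differ X f g" if "z \<in> X \<inter> ball x r" for z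
  proof -
    have "dist (dist (f z) (g z)) (dist (f x) (g x)) < dist (f x) (g x)"
      using that by (intro r) (auto simp: dist_commute)
    then have "f z \<noteq> g z"
      using pos by (auto simp: dist_real_def)
    then show ?thesis
      using that by (simp add: differ_def)
  qed
  then show ?thesis
    using \<open>r > 0\<close> by blast
qed

lemma agree_on_closure:
  assumes "f \<in> cfuns X" "g \<in> cfuns X" "x \<in> X" "x \<in> closure C" "C \<subseteq> X" "differ X f g \<inter> C = {}"
  shows "f x = g x"
proof (rule ccontr)
  assume "f x \<noteq> g x"
  then obtain r where r: "r > 0" "X \<inter> ball x r \<subseteq> differ X f g"
    using differ_open[of f X g x] assms by (auto simp: differ_def)
  obtain z where "z \<in> C" "dist z x < r"
    using assms r closure_approachable by metis
  then show False
    using r assms by (auto simp: dist_commute)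
qed

section \<open>Constructions of continuous functions\<close>

lemma exists_differ_eq_ball:
  assumes "\<exists>u::'e::real_normed_vector. u \<noteq> 0" and h: "h \<in> cfuns X"
  shows "\<exists>f \<in> cfuns X. differ X f (h :: 'a::metric_space \<Rightarrow> 'e) = X \<inter> ball c r"
proof -
  obtain u :: 'e where u: "u \<noteq> 0" using assms by auto
  let ?f = "\<lambda>x\<in>X. h x + max 0 (r - dist c x) *\<^sub>R u"
  have "?f \<in> cfuns X"
    using cfunsD[OF h] by (intro restrict_cfuns continuous_intros)
  moreover have "differ X ?f h = X \<inter> ball c r"
    using u by (auto simp: differ_def max_def split: if_splits)
  ultimately show ?thesis by blast
qed

lemma continuous_within_squeeze_scaleR:
  fixes d :: "'a::metric_space \<Rightarrow> 'e::real_normed_vector"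
  assumes "continuous (at z within X) d" "d z = 0" "\<And>w. \<bar>c w\<bar> \<le> (1::real)"
  shows "continuous (at z within X) (\<lambda>w. c w *\<^sub>R d w)"
proof -
  have "(d \<longlongrightarrow> 0) (at z within X)"
    using assms by (simp add: continuous_within)
  then have "((\<lambda>w. c w *\<^sub>R d w) \<longlongrightarrow> 0) (at z within X)"
    by (rule Lim_null_comparison[rotated, OF tendsto_norm_zero])
       (use assms in \<open>auto intro!: always_eventually mult_left_le_one_le\<close>)
  then show ?thesis
    using assms by (simp add: continuous_within)
qed

text \<open>
  The gluing tool of the whole development.  A Urysohn function that separates \<open>A\<close> from \<open>B\<close>
  and is locally constant near each of them, away from the common closure points, weighs \<open>p\<close>
  against \<open>q\<close>.  Near a common closure point the weight may oscillate, but there \<open>p\<close> and \<open>q\<close> agree,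
  so continuity survives.  Allowing such points is what makes alternation along a
  convergent sequence possible.
\<close>

lemma interpolation:
  fixes p q :: "'a::metric_space \<Rightarrow> 'e::real_normed_vector"
  assumes p: "p \<in> cfuns X" and q: "q \<in> cfuns X"
    and eq: "\<And>z. \<lbrakk>z \<in> X; z \<in> closure A; z \<in> closure B\<rbrakk> \<Longrightarrow> p z = q z"
  shows "\<exists>k \<in> cfuns X.
    (\<forall>z \<in> X \<inter> closure A - closure B. z \<notin> closure (differ X k p)) \<and>
    (\<forall>z \<in> X \<inter> closure B - closure A. z \<notin> closure (differ X k q))"
proof (cases "A = {} \<or> B = {}")
  case True
  then show ?thesis
    using p q by (auto simp: differ_def intro: bexI[of _ p] bexI[of _ q])
next
  case False
  define a where "a z = infdist z A" for z
  define b where "b z = infdist z B" for z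
  \<comment> \<open>Rescaling and truncating \<open>a / (a + b)\<close> makes the weight equal to \<open>0\<close> where
      \<open>2 * a < b\<close> and to \<open>1\<close> where \<open>2 * b < a\<close>, so that agreement holds on neighbourhoods.\<close>
  define c where "c z = max 0 (min 1 (3 * (a z / (a z + b z)) - 1))" for z
  have a0: "a z \<ge> 0" "b z \<ge> 0" for z
    by (auto simp: a_def b_def infdist_nonneg)
  have a_iff: "a z = 0 \<longleftrightarrow> z \<in> closure A" and b_iff: "b z = 0 \<longleftrightarrow> z \<in> closure B" for z
    using False by (auto simp: a_def b_def in_closure_iff_infdist_zero)
  have cont_a: "continuous_on UNIV a" and cont_b: "continuous_on UNIV b"
    by (auto simp: a_def b_def intro!: continuous_intros)
  let ?k = "\<lambda>z\<in>X. p z + c z *\<^sub>R (q z - p z)"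
  have "continuous (at z within X) (\<lambda>z. p z + c z *\<^sub>R (q z - p z))" if z: "z \<in> X" for z
  proof -
    have pz: "continuous (at z within X) p" and qz: "continuous (at z within X) q"
      using cfunsD[OF p] cfunsD[OF q] z by (auto simp: continuous_on_eq_continuous_within)
    have ab: "continuous (at z within X) a" "continuous (at z within X) b"
      using cont_a cont_b by (auto simp: continuous_on_eq_continuous_within intro: continuous_within_subset)
    show ?thesis
    proof (cases "a z + b z = 0")
      case True
      then have "p z = q z"
        using a0[of z] a_iff b_iff eq z by (auto simp: add_nonneg_eq_0_iff)
      then have "continuous (at z within X) (\<lambda>z. c z *\<^sub>R (q z - p z))"
        by (intro continuous_within_squeeze_scaleR continuous_intros pz qz) (auto simp: c_def)
      then show ?thesis
        by (rule continuous_add[OF pz])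
    next
      case False
      have "continuous (at z within X) c"
        unfolding c_def using ab False by (intro continuous_intros) auto
      then show ?thesis
        using pz qz by (intro continuous_intros)
    qed
  qed
  then have k: "?k \<in> cfuns X"
    by (intro restrict_cfuns) (auto simp: continuous_on_eq_continuous_within)
  have "z \<notin> closure (differ X ?k p)" if z: "z \<in> closure A" "z \<notin> closure B" for z
  proof -
    let ?U = "{w. 2 * a w < b w}"
    have "open ?U"
      by (intro open_Collect_less continuous_intros cont_a cont_b)
    moreover have "z \<in> ?U"
      using z a_iff[of z] b_iff[of z] a0(2)[of z] unfolding mem_Collect_eq by linarith
    moreover have "?U \<inter> differ X ?k p = {}"
    proof -
      have "c w = 0" if "2 * a w < b w" for w
      proof -
        have "3 * (a w / (a w + b w)) \<le> 1"
          using that a0[of w] by (simp add: field_simps)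
        then show ?thesis by (simp add: c_def)
      qed
      then show ?thesis by (auto simp: differ_def)
    qed
    ultimately show ?thesis
      using open_Int_closure_eq_empty by blast
  qed
  moreover have "z \<notin> closure (differ X ?k q)" if z: "z \<in> closure B" "z \<notin> closure A" for z
  proof -
    let ?U = "{w. 2 * b w < a w}"
    have "open ?U"
      by (intro open_Collect_less continuous_intros cont_a cont_b)
    moreover have "z \<in> ?U"
      using z a_iff[of z] b_iff[of z] a0(1)[of z] unfolding mem_Collect_eq by linarith
    moreover have "?U \<inter> differ X ?k q = {}"
    proof -
      have "c w = 1" if "2 * b w < a w" for w
      proof -
        have "3 * (a w / (a w + b w)) \<ge> 2"
          using that a0[of w] by (simp add: field_simps)
        then show ?thesis by (simp add: c_def)
      qed
      then show ?thesis by (auto simp: differ_def)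
    qed
    ultimately show ?thesis
      using open_Int_closure_eq_empty by blast
  qed
  ultimately show ?thesis
    using k by blast
qed

lemma sum_half_powers_le: "(\<Sum>n=N..<M. (1/2::real) ^ n) \<le> 2 * (1/2) ^ N"
proof (cases "N \<le> M")
  case True
  then have "(\<Sum>n=N..<M. (1/2::real) ^ n) = 2 * (1/2) ^ N - 2 * (1/2) ^ M"
    by (induction M rule: dec_induct) auto
  then show ?thesis by simp
qed simp

text \<open>
  A property that holds for values near \<open>e0\<close> at points arbitrarily close to \<open>x0\<close> holds for the
  values of a single continuous function.  Choose points whose distances to \<open>x0\<close> drop so quickly
  that tents of height \<open>1\<close> and of radius half these distances vanish at all the other chosen points,
  and scale the tents by the increments \<open>e n - e0\<close>.  The increments decay geometrically and only
  finitely many tents are nonzero at a given point, so the sum is a uniform limit of continuous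
  functions even if the normed space is not complete.
\<close>

lemma exists_function_through_sequence:
  fixes x0 :: "'a::metric_space" and e0 :: "'e::real_normed_vector"
  assumes P: "\<And>\<delta>. \<delta> > 0 \<Longrightarrow> \<exists>x e. x \<in> X \<and> x \<noteq> x0 \<and> dist x x0 < \<delta> \<and> dist e e0 < \<delta> \<and> P x e"
    and x0: "x0 \<in> X"
  shows "\<exists>f \<in> cfuns X. f x0 = e0 \<and> (\<forall>\<delta>>0. \<exists>x\<in>X. dist x x0 < \<delta> \<and> P x (f x))"
proof -
  define good where "good n s \<longleftrightarrow> fst s \<in> X \<and> fst s \<noteq> x0 \<and> dist (fst s) x0 < (1/2)^n \<and>
      dist (snd s) e0 < (1/2)^n \<and> P (fst s) (snd s)" for n and s :: "'a \<times> 'e"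
  have "\<exists>s. \<forall>n. good n (s n) \<and> dist (fst (s (Suc n))) x0 < dist (fst (s n)) x0 / 4"
  proof (rule dependent_nat_choice)
    show "\<exists>s. good 0 s"
      using P[of 1] by (auto simp: good_def)
    fix s n
    assume "good n s"
    then have "min ((1/2)^Suc n) (dist (fst s) x0 / 4) > 0"
      by (simp add: good_def)
    from P[OF this] show "\<exists>t. good (Suc n) t \<and> dist (fst t) x0 < dist (fst s) x0 / 4"
      by (auto simp: good_def)
  qed
  then obtain s where good: "\<And>n. good n (s n)"
    and dec: "\<And>n. dist (fst (s (Suc n))) x0 < dist (fst (s n)) x0 / 4" by auto
  define x where "x n = fst (s n)" for n
  define e where "e n = snd (s n)" for n
  define d where "d n = dist (x n) x0" for n
  have x: "x n \<in> X" and dpos: "d n > 0" and dlt: "d n < (1/2)^n" and elt: "dist (e n) e0 < (1/2)^n"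
    and Pn: "P (x n) (e n)" for n
    using good[of n] by (auto simp: good_def x_def d_def e_def)
  have ddec: "d m < d n / 4" if "n < m" for m n
    using that
  proof (induction m)
    case (Suc m)
    have "d (Suc m) < d m / 4" using dec by (simp add: d_def x_def)
    moreover have "d m \<le> d n"
      using Suc dpos[of n] by (cases "n = m") (auto simp: less_Suc_eq)
    ultimately show ?case by simp
  qed simp
  define \<beta> where "\<beta> n z = max 0 (1 - dist z (x n) / (d n / 2))" for n z
  have \<beta>01: "0 \<le> \<beta> n z" "\<beta> n z \<le> 1" for n z
    using dpos[of n] by (auto simp: \<beta>_def)
  have \<beta>0: "\<beta> n z = 0" if "dist z (x n) \<ge> d n / 2" for n z
    using that dpos[of n] by (simp add: \<beta>_def field_simps)
  have \<beta>_x0: "\<beta> n x0 = 0" for n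
    using dpos[of n] by (intro \<beta>0) (simp add: d_def dist_commute)
  have \<beta>_self: "\<beta> n (x n) = 1" for n
    by (simp add: \<beta>_def)
  have \<beta>_other: "\<beta> n (x m) = 0" if "m \<noteq> n" for m n
  proof (rule \<beta>0)
    have "\<bar>d m - d n\<bar> \<le> dist (x m) (x n)"
      unfolding d_def using abs_dist_diff_le[of "x m" x0 "x n"] by (simp add: dist_commute)
    moreover have "d m < d n / 4 \<or> d n < d m / 4"
      using that ddec[of m n] ddec[of n m] by linarith
    ultimately show "d n / 2 \<le> dist (x m) (x n)"
      using dpos[of n] dpos[of m] by linarith
  qed
  have ev: "\<exists>M. \<forall>n\<ge>M. \<beta> n z = 0" for z
  proof (cases "z = x0")
    case False
    then have "dist z x0 / 2 > 0" by simp
    then have "\<exists>M. (1/2)^M < dist z x0 / 2"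
      by (rule real_arch_pow_inv) simp
    then obtain M where M: "(1/2)^M < dist z x0 / 2" ..
    have "\<beta> n z = 0" if "n \<ge> M" for n
    proof (rule \<beta>0)
      have "(1/2::real)^n \<le> (1/2)^M"
        using that by (intro power_decreasing) auto
      moreover have "dist z x0 \<le> dist z (x n) + d n"
        unfolding d_def by (rule dist_triangle)
      ultimately show "d n / 2 \<le> dist z (x n)"
        using M dlt[of n] dpos[of n] by linarith
    qed
    then show ?thesis by blast
  qed (use \<beta>_x0 in auto)
  define F where "F N z = e0 + (\<Sum>n<N. \<beta> n z *\<^sub>R (e n - e0))" for N z
  define f where "f z = e0 + (\<Sum>n. \<beta> n z *\<^sub>R (e n - e0))" for z
  have f_eq: "f z = F M z" if "\<And>n. n \<ge> M \<Longrightarrow> \<beta> n z = 0" for M z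
    unfolding f_def F_def using that by (subst suminf_finite[of "{..<M}"]) auto
  have close: "dist (F N z) (f z) \<le> 2 * (1/2)^N" for N z
  proof -
    obtain M0 where M0: "\<And>n. n \<ge> M0 \<Longrightarrow> \<beta> n z = 0" using ev by blast
    define M where "M = max M0 N"
    have "f z - F N z = (\<Sum>n=N..<M. \<beta> n z *\<^sub>R (e n - e0))"
      using M0 by (subst f_eq[of M])
        (auto simp: F_def M_def sum_diff_nat_ivl lessThan_atLeast0)
    also have "norm \<dots> \<le> (\<Sum>n=N..<M. (1/2)^n)"
    proof (rule sum_norm_le)
      fix n
      have "\<beta> n z * norm (e n - e0) \<le> 1 * (1/2)^n"
        using \<beta>01 elt[of n] by (intro mult_mono) (auto simp: dist_norm less_imp_le)
      then show "norm (\<beta> n z *\<^sub>R (e n - e0)) \<le> (1/2)^n"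
        using \<beta>01[of n z] by simp
    qed
    also have "\<dots> \<le> 2 * (1/2)^N" by (rule sum_half_powers_le)
    finally show ?thesis by (simp add: dist_norm norm_minus_commute)
  qed
  have "continuous_on X f"
  proof (rule uniform_limit_theorem[of _ F sequentially])
    show "\<forall>\<^sub>F N in sequentially. continuous_on X (F N)"
      unfolding F_def \<beta>_def using dpos
      by (intro always_eventually allI continuous_intros) (auto simp: less_le)
    have "((\<lambda>N. 2 * (1/2)^N) \<longlonglongrightarrow> (2 * 0 :: real))"
      by (intro tendsto_intros) auto
    show "uniform_limit X F f sequentially"
    proof (rule uniform_limitI)
      fix \<epsilon> :: real assume "\<epsilon> > 0"
      then have "\<forall>\<^sub>F N in sequentially. 2 * (1/2)^N < \<epsilon>"
        using order_tendstoD(2)[OF \<open>(\<lambda>N. 2 * (1/2)^N) \<longlonglongrightarrow> (2 * 0 :: real)\<close>, of \<epsilon>] by simp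
      then show "\<forall>\<^sub>F N in sequentially. \<forall>z\<in>X. dist (F N z) (f z) < \<epsilon>"
        by eventually_elim (use close le_less_trans in blast)
    qed
  qed auto
  have fx: "f (x n) = e n" for n
  proof -
    have "f (x n) = F (Suc n) (x n)"
      by (rule f_eq) (use \<beta>_other in auto)
    then show ?thesis by (simp add: F_def \<beta>_self \<beta>_other)
  qed
  have fx0: "f x0 = e0"
    using f_eq[of 0 x0] \<beta>_x0 by (simp add: F_def)
  have "\<exists>z\<in>X. dist z x0 < \<delta> \<and> P z (f z)" if "\<delta> > 0" for \<delta>
  proof -
    have "\<exists>n. (1/2)^n < \<delta>"
      using that by (rule real_arch_pow_inv) simp
    then obtain n where n: "(1/2)^n < \<delta>" ..
    then show ?thesis
      using n dlt[of n] Pn[of n] x[of n] fx[of n] by (auto simp: d_def intro!: bexI[of _ "x n"])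
  qed
  then show ?thesis
    using x0 fx0 x restrict_cfuns[OF \<open>continuous_on X f\<close>] by (intro bexI[of _ "restrict f X"]) auto
qed

section \<open>Separation of different bases\<close>

text \<open>
  A biseparating map is kept together with its inverse \<open>S\<close>, because the hypotheses are then
  symmetric and every lemma can be applied in both directions.
\<close>

locale biseparating_pair =
  fixes X :: "'a::metric_space set" and Y :: "'b::metric_space set"
    and T :: "('a \<Rightarrow> 'e::real_normed_vector) \<Rightarrow> ('b \<Rightarrow> 'f::real_normed_vector)"
    and S :: "('b \<Rightarrow> 'f) \<Rightarrow> ('a \<Rightarrow> 'e)"
  assumes nontrivial_domain: "\<exists>u::'e. u \<noteq> 0"
    and nontrivial_codomain: "\<exists>v::'f. v \<noteq> 0"
    and T_cfuns: "\<And>f. f \<in> cfuns X \<Longrightarrow> T f \<in> cfuns Y"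
    and S_cfuns: "\<And>g. g \<in> cfuns Y \<Longrightarrow> S g \<in> cfuns X"
    and S_T: "\<And>f. f \<in> cfuns X \<Longrightarrow> S (T f) = f"
    and T_S: "\<And>g. g \<in> cfuns Y \<Longrightarrow> T (S g) = g"
    and perp_T: "\<And>f g h. \<lbrakk>f \<in> cfuns X; g \<in> cfuns X; h \<in> cfuns X\<rbrakk> \<Longrightarrow>
      perp Y (T h) (T f) (T g) \<longleftrightarrow> perp X h f g"
begin

lemma flip: "biseparating_pair Y X S T"
proof
  show "perp X (S h) (S f) (S g) \<longleftrightarrow> perp Y h f g" if "f \<in> cfuns Y" "g \<in> cfuns Y" "h \<in> cfuns Y" for f g h
    using that by (simp add: S_cfuns T_S flip: perp_T)
qed (use nontrivial_domain nontrivial_codomain T_cfuns S_cfuns S_T T_S in auto)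

lemma differ_T_disjoint:
  assumes "f \<in> cfuns X" "g \<in> cfuns X" "h \<in> cfuns X"
  shows "differ Y (T f) (T h) \<inter> differ Y (T g) (T h) = {} \<longleftrightarrow> differ X f h \<inter> differ X g h = {}"
  using perp_T[OF assms] by (simp add: perp_iff_differ)

text \<open>
  Disjointness with respect to a single base controls two unrelated bases.  A function equal to
  \<open>g\<close> on \<open>differ X f g\<close> and to \<open>k\<close> on \<open>differ X h k\<close> is disjoint from \<open>f\<close> relative to \<open>g\<close> and from \<open>h\<close>
  relative to \<open>k\<close>, so at a common point of the two sets in the conclusion its image equals
  both \<open>T g\<close> and \<open>T k\<close>.  The same argument with \<open>f\<close> and \<open>g\<close> exchanged shows that \<open>T f\<close> equals \<open>T k\<close>
  there as well, so \<open>T f\<close> and \<open>T g\<close> agree at a point where they were supposed to differ.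
\<close>

lemma separation:
  assumes f: "f \<in> cfuns X" and g: "g \<in> cfuns X" and h: "h \<in> cfuns X" and k: "k \<in> cfuns X"
    and sep: "X \<inter> closure (differ X f g) \<inter> closure (differ X h k) = {}"
  shows "differ Y (T f) (T g) \<inter> differ Y (T h) (T k) = {}"
proof -
  have glue: "\<exists>w \<in> cfuns X. (\<forall>x \<in> differ X f g. w x = p x) \<and> (\<forall>x \<in> differ X h k. w x = k x)"
    if p: "p \<in> cfuns X" for p
  proof -
    obtain w where w: "w \<in> cfuns X"
      "\<forall>z \<in> X \<inter> closure (differ X f g) - closure (differ X h k). z \<notin> closure (differ X w p)"
      "\<forall>z \<in> X \<inter> closure (differ X h k) - closure (differ X f g). z \<notin> closure (differ X w k)"
      using interpolation[OF p k, of "differ X f g" "differ X h k"] sep by blast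
    have X: "differ X f g \<subseteq> X" "differ X h k \<subseteq> X" by (auto simp: differ_def)
    have "w x = p x" if "x \<in> differ X f g" for x
    proof -
      have "x \<notin> differ X w p"
        using that w X sep closure_subset by blast
      then show ?thesis using that by (simp add: differ_def)
    qed
    moreover have "w x = k x" if "x \<in> differ X h k" for x
    proof -
      have "x \<notin> differ X w k"
        using that w X sep closure_subset by blast
      then show ?thesis using that by (simp add: differ_def)
    qed
    ultimately show ?thesis
      using w by blast
  qed
  have agree: "T w y = T b y"
    if "w \<in> cfuns X" "a \<in> cfuns X" "b \<in> cfuns X" "\<forall>x \<in> differ X a b. w x = b x" "y \<in> differ Y (T a) (T b)"
    for w a b y
  proof -
    have "differ X w b \<inter> differ X a b = {}"
      using that by (auto simp: differ_def)
    then have "differ Y (T w) (T b) \<inter> differ Y (T a) (T b) = {}"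
      using differ_T_disjoint that by blast
    then show ?thesis using that by (auto simp: differ_def)
  qed
  obtain w where w: "w \<in> cfuns X" "\<forall>x \<in> differ X f g. w x = g x" "\<forall>x \<in> differ X h k. w x = k x"
    using glue[OF g] by blast
  obtain w' where w': "w' \<in> cfuns X" "\<forall>x \<in> differ X f g. w' x = f x" "\<forall>x \<in> differ X h k. w' x = k x"
    using glue[OF f] by blast
  show ?thesis
  proof (rule ccontr)
    assume "differ Y (T f) (T g) \<inter> differ Y (T h) (T k) \<noteq> {}"
    then obtain y where y: "y \<in> differ Y (T f) (T g)" "y \<in> differ Y (T h) (T k)" by blast
    have "T w y = T g y" "T w y = T k y" "T w' y = T f y" "T w' y = T k y"
      using agree[of w f g y] agree[of w h k y] agree[of w' g f y] agree[of w' h k y]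
        y w w' f g h k by (auto simp: differ_commute)
    then show False
      using y by (simp add: differ_def)
  qed
qed

section \<open>Linked points\<close>

text \<open>
  The condition \<open>x \<notin> closure (differ X f g)\<close> says that \<open>f\<close> and \<open>g\<close> agree on a neighbourhood of \<open>x\<close>
  in \<open>X\<close>.  Both implications are included so that the relation is symmetric under exchanging \<open>T\<close>
  with its inverse; the first determines \<open>x\<close> from \<open>y\<close>, the second \<open>y\<close> from \<open>x\<close>.
\<close>

definition linked :: "'a \<Rightarrow> 'b \<Rightarrow> bool" where
  "linked x y \<longleftrightarrow> x \<in> X \<and> y \<in> Y \<and>
    (\<forall>f \<in> cfuns X. \<forall>g \<in> cfuns X.
      (x \<notin> closure (differ X f g) \<longrightarrow> T f y = T g y) \<and>
      (y \<notin> closure (differ Y (T f) (T g)) \<longrightarrow> f x = g x))"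

lemma linked_flip:
  assumes "linked x y"
  shows "biseparating_pair.linked Y X S y x"
proof -
  interpret flip: biseparating_pair Y X S T by (rule flip)
  have "(y \<notin> closure (differ Y f g) \<longrightarrow> S f x = S g x) \<and>
      (x \<notin> closure (differ X (S f) (S g)) \<longrightarrow> f y = g y)"
    if "f \<in> cfuns Y" "g \<in> cfuns Y" for f g
  proof -
    have "S f \<in> cfuns X" "S g \<in> cfuns X" "T (S f) = f" "T (S g) = g"
      using that S_cfuns T_S by auto
    then show ?thesis
      using assms unfolding linked_def by metis
  qed
  then show ?thesis
    using assms unfolding flip.linked_def linked_def by blast
qed

lemma linked_sym: "linked x y \<longleftrightarrow> biseparating_pair.linked Y X S y x"
  using linked_flip biseparating_pair.linked_flip[OF flip] by blast

lemma exists_T_neq: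
  assumes "y \<in> Y"
  shows "\<exists>p \<in> cfuns X. \<exists>q \<in> cfuns X. T p y \<noteq> T q y"
proof -
  obtain v :: 'f where v: "v \<noteq> 0" using nontrivial_codomain by auto
  have "T (S (\<lambda>y\<in>Y. 0)) y \<noteq> T (S (\<lambda>y\<in>Y. v)) y"
    using v assms by (simp add: T_S restrict_const_cfuns)
  then show ?thesis using S_cfuns restrict_const_cfuns by blast
qed

lemma linked_unique_left:
  assumes "linked x y" "linked x' y"
  shows "x = x'"
proof (rule ccontr)
  assume neq: "x \<noteq> x'"
  have xy: "x \<in> X" "x' \<in> X" "y \<in> Y" using assms by (auto simp: linked_def)
  obtain p q where pq: "p \<in> cfuns X" "q \<in> cfuns X" "T p y \<noteq> T q y"
    using exists_T_neq xy by blast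
  obtain k where k: "k \<in> cfuns X" "x \<notin> closure (differ X k p)" "x' \<notin> closure (differ X k q)"
    using interpolation[OF pq(1,2), of "{x}" "{x'}"] neq xy by auto
  then have "T k y = T p y" "T k y = T q y"
    using assms pq by (auto simp: linked_def)
  then show False using pq by simp
qed

text \<open>
  The set \<open>differ X f h\<close> is, roughly, what \<open>T\<close> carries to the ball around \<open>y\<close>.  A perturbation of \<open>h\<close>
  supported in a small ball around \<open>x\<close> is not disjoint from \<open>f\<close>, so its image differs from \<open>T h\<close>
  somewhere in the ball around \<open>y\<close>, and by separation \<open>T p\<close> and \<open>T q\<close> agree at such a point.
\<close>

lemma exists_agreement_near:
  assumes y: "y \<in> Y" and "f \<in> cfuns X" "h \<in> cfuns X" "p \<in> cfuns X" "q \<in> cfuns X"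
    and f: "differ Y (T f) (T h) = Y \<inter> ball y r"
    and x: "x \<in> differ X f h" "x \<notin> closure (differ X p q)"
  shows "\<exists>y' \<in> Y \<inter> ball y r. T p y' = T q y'"
proof -
  obtain s where s: "s > 0" "cball x s \<subseteq> - closure (differ X p q)"
    using x open_contains_cball[of "- closure (differ X p q)"] by auto
  obtain l where l: "l \<in> cfuns X" "differ X l h = X \<inter> ball x s"
    using exists_differ_eq_ball[OF nontrivial_domain] assms by metis
  have "closure (differ X l h) \<subseteq> cball x s"
    unfolding l by (rule closure_minimal) auto
  then have "differ Y (T l) (T h) \<inter> differ Y (T p) (T q) = {}"
    using s assms l by (intro separation) auto
  moreover have "x \<in> differ X l h"
    using x s by (auto simp: l(2)) (auto simp: differ_def)
  then have "differ Y (T l) (T h) \<inter> differ Y (T f) (T h) \<noteq> {}"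
    using x differ_T_disjoint[of l f h] l assms by blast
  ultimately show ?thesis
    using f by (auto simp: differ_def)
qed

text \<open>
  The linked point is a common closure point of the sets \<open>C n\<close> that correspond to the balls
  of radius \<open>1 / (n + 1)\<close> around \<open>y\<close>.  No compactness is available to produce it;
  instead, its absence would allow two arbitrary functions to be glued along a closed discrete set.
\<close>

lemma linked_ex_left:
  assumes y: "y \<in> Y"
  shows "\<exists>x. linked x y"
proof -
  interpret flip: biseparating_pair Y X S T by (rule flip)
  define h :: "'a \<Rightarrow> 'e" where "h = (\<lambda>x\<in>X. 0)"
  have h: "h \<in> cfuns X" by (simp add: h_def restrict_const_cfuns)
  define r where "r n = inverse (real (Suc n))" for n
  have r: "r n > 0" for n by (simp add: r_def)
  have r_small: "\<exists>N. \<forall>n\<ge>N. r n < \<epsilon>" if "\<epsilon> > 0" for \<epsilon>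
  proof -
    obtain N where "inverse (real (Suc N)) < \<epsilon>" using reals_Archimedean[OF \<open>\<epsilon> > 0\<close>] by blast
    moreover have "r n \<le> r N" if "N \<le> n" for n using that by (simp add: r_def le_imp_inverse_le)
    ultimately show ?thesis by (metis le_less_trans r_def)
  qed
  have "\<forall>n. \<exists>f. f \<in> cfuns X \<and> differ Y (T f) (T h) = Y \<inter> ball y (r n)"
    using exists_differ_eq_ball[OF nontrivial_codomain T_cfuns[OF h]] S_cfuns T_S by metis
  then obtain f where f: "\<And>n. f n \<in> cfuns X"
    and Tf: "\<And>n. differ Y (T (f n)) (T h) = Y \<inter> ball y (r n)" by metis
  define C where "C n = differ X (f n) h" for n
  have CX: "C n \<subseteq> X" for n by (auto simp: C_def differ_def)
  have C_ne: "C n \<noteq> {}" for n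
  proof
    assume "C n = {}"
    then have "f n = h"
      using cfuns_eqI[OF f h] by (auto simp: C_def differ_def)
    then show False
      using Tf[of n] y r[of n] by (auto simp: differ_def)
  qed
  have C_mono: "C n \<subseteq> closure (C m)" if "m \<le> n" for m n
  proof
    fix z assume z: "z \<in> C n"
    show "z \<in> closure (C m)"
    proof (rule ccontr)
      assume "z \<notin> closure (C m)"
      then obtain s where s: "s > 0" "ball z s \<subseteq> - closure (C m)"
        using open_contains_ball[of "- closure (C m)"] by auto
      obtain l where l: "l \<in> cfuns X" "differ X l h = X \<inter> ball z s"
        using exists_differ_eq_ball[OF nontrivial_domain h] by metis
      have "differ X l h \<inter> differ X (f m) h = {}"
        using s l closure_subset by (fastforce simp: C_def)
      then have "differ Y (T l) (T h) \<inter> differ Y (T (f m)) (T h) = {}"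
        using differ_T_disjoint f h l by blast
      moreover have "r n \<le> r m" using that by (simp add: r_def le_imp_inverse_le)
      ultimately have "differ Y (T l) (T h) \<inter> differ Y (T (f n)) (T h) = {}"
        unfolding Tf by (auto dest: less_le_trans)
      then have "differ X l h \<inter> C n = {}"
        unfolding C_def using differ_T_disjoint f h l by blast
      moreover have "z \<in> X \<inter> ball z s" using z s CX by auto
      ultimately show False using z by (auto simp: l(2))
    qed
  qed
  \<comment> \<open>Agreement of \<open>p\<close> and \<open>q\<close> near points of infinitely many \<open>C n\<close> gives agreement of the
      images at points tending to \<open>y\<close>.\<close>
  have limit: "T p y = T q y"
    if pq: "p \<in> cfuns X" "q \<in> cfuns X" and hits: "\<forall>N. \<exists>n\<ge>N. \<exists>x \<in> C n. x \<notin> closure (differ X p q)" for p q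
  proof (rule ccontr)
    assume "T p y \<noteq> T q y"
    then obtain s where s: "s > 0" "Y \<inter> ball y s \<subseteq> differ Y (T p) (T q)"
      using differ_open[OF T_cfuns T_cfuns, OF pq, of y] y by (auto simp: differ_def)
    obtain N where N: "\<forall>n\<ge>N. r n < s" using r_small s by blast
    obtain n x where n: "n \<ge> N" and x: "x \<in> C n" "x \<notin> closure (differ X p q)" using hits by blast
    obtain y' where y': "y' \<in> Y \<inter> ball y (r n)" "T p y' = T q y'"
      using exists_agreement_near[OF y f h pq Tf] x unfolding C_def by blast
    moreover have "y' \<in> Y \<inter> ball y s" using y' N n by (force dest: less_trans)
    ultimately show False using s by (auto simp: differ_def)
  qed
  have "\<exists>x \<in> X. \<forall>n. x \<in> closure (C n)"
  proof (rule ccontr)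
    assume "\<not> ?thesis"
    then have none: "\<And>z. z \<in> X \<Longrightarrow> \<exists>N. z \<notin> closure (C N)" by blast
    have "\<forall>n. \<exists>z. z \<in> C n" using C_ne by blast
    then obtain x where x: "\<And>n. x n \<in> C n" by metis
    \<comment> \<open>The chosen points may repeat, but they leave a neighbourhood of every point of \<open>X\<close>;
        hence their range is infinite and all of its subsets are closed in \<open>X\<close>.\<close>
    have escape: "\<exists>N \<epsilon>. \<epsilon> > 0 \<and> (\<forall>n\<ge>N. x n \<notin> ball z \<epsilon>)" if "z \<in> X" for z
    proof -
      obtain N where "z \<notin> closure (C N)" using none \<open>z \<in> X\<close> by blast
      then obtain \<epsilon> where "\<epsilon> > 0" "ball z \<epsilon> \<subseteq> - closure (C N)"
        using open_contains_ball[of "- closure (C N)"] by auto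
      then show ?thesis using x C_mono by blast
    qed
    have closed: "z \<in> B" if z: "z \<in> X" "z \<in> closure B" and B: "B \<subseteq> range x" for z B
    proof (rule ccontr)
      assume "z \<notin> B"
      then have "z islimpt B" using z by (auto simp: closure_def)
      obtain N \<epsilon> where N: "\<epsilon> > 0" "\<forall>n\<ge>N. x n \<notin> ball z \<epsilon>" using escape z by blast
      then have "B \<inter> ball z \<epsilon> \<subseteq> x ` {..<N}" using B by (force simp: not_le)
      then have "finite (B \<inter> ball z \<epsilon>)" by (rule finite_subset) auto
      then show False
        using \<open>z islimpt B\<close> N by (simp add: islimpt_eq_infinite_ball)
    qed
    have "infinite (range x)"
    proof
      assume "finite (range x)"
      then obtain n where "infinite (x -` {x n})"
        using inf_img_fin_dom[of x UNIV] by auto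
      moreover obtain N \<epsilon> where N: "\<epsilon> > 0" "\<forall>m\<ge>N. x m \<notin> ball (x n) \<epsilon>"
        using escape CX x by blast
      then have "x -` {x n} \<subseteq> {..<N}" by (force simp: not_le)
      ultimately show False using finite_subset by blast
    qed
    then obtain i :: "nat \<Rightarrow> 'a" where i: "inj i" "range i \<subseteq> range x"
      using infinite_countable_subset by blast
    \<comment> \<open>An injective enumeration splits the range into two infinite sets.\<close>
    define A where "A = i ` {n. even n}"
    define B where "B = i ` {n. odd n}"
    have AB: "A \<subseteq> range x" "B \<subseteq> range x" "A \<inter> B = {}"
      using i by (auto simp: A_def B_def inj_def)
    have "infinite {n::nat. even n}" "infinite {n::nat. odd n}"
      unfolding infinite_nat_iff_unbounded_le mem_Collect_eq
      by (meson dual_order.refl even_Suc le_SucI)+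
    then have inf: "infinite A" "infinite B"
      using i by (auto simp: A_def B_def finite_image_iff inj_on_def inj_def)
    have often: "\<forall>N. \<exists>n\<ge>N. x n \<in> D" if "infinite D" "D \<subseteq> range x" for D
    proof (rule ccontr)
      assume "\<not> ?thesis"
      then obtain N where "\<forall>n\<ge>N. x n \<notin> D" by blast
      then have "D \<subseteq> x ` {..<N}" using that by (force simp: not_le)
      then show False using that finite_subset by blast
    qed
    obtain p q where pq: "p \<in> cfuns X" "q \<in> cfuns X" "T p y \<noteq> T q y"
      using exists_T_neq y by blast
    have disj: "z \<notin> closure A \<or> z \<notin> closure B" if "z \<in> X" for z
      using closed[OF that] AB by blast
    then obtain k where k: "k \<in> cfuns X"
      "\<forall>z \<in> X \<inter> closure A - closure B. z \<notin> closure (differ X k p)"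
      "\<forall>z \<in> X \<inter> closure B - closure A. z \<notin> closure (differ X k q)"
      using interpolation[OF pq(1,2), of A B] by blast
    have xX: "x n \<in> X" for n using x CX by blast
    have kA: "x n \<notin> closure (differ X k p)" if "x n \<in> A" for n
      using that k(2) disj[OF xX[of n]] xX[of n] closure_subset by blast
    have kB: "x n \<notin> closure (differ X k q)" if "x n \<in> B" for n
      using that k(3) disj[OF xX[of n]] xX[of n] closure_subset by blast
    have "T k y = T p y"
      using limit[OF k(1) pq(1)] often[OF inf(1) AB(1)] kA x by blast
    moreover have "T k y = T q y"
      using limit[OF k(1) pq(2)] often[OF inf(2) AB(2)] kB x by blast
    ultimately show False using pq by simp
  qed
  then obtain x where x: "x \<in> X" "\<And>n. x \<in> closure (C n)" by blast
  have "T p y = T q y" if pq: "p \<in> cfuns X" "q \<in> cfuns X" and far: "x \<notin> closure (differ X p q)" for p q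
  proof (rule limit[OF pq], intro allI)
    fix N
    have "- closure (differ X p q) \<inter> C N \<noteq> {}"
      using x(2)[of N] far open_Int_closure_eq_empty[of "- closure (differ X p q)" "C N"] by auto
    then show "\<exists>n\<ge>N. \<exists>x \<in> C n. x \<notin> closure (differ X p q)" by blast
  qed
  moreover have "p x = q x"
    if pq: "p \<in> cfuns X" "q \<in> cfuns X" and far: "y \<notin> closure (differ Y (T p) (T q))" for p q
  proof -
    obtain s where s: "s > 0" "cball y s \<subseteq> - closure (differ Y (T p) (T q))"
      using far open_contains_cball[of "- closure (differ Y (T p) (T q))"] by auto
    obtain n where n: "r n < s" using r_small s by blast
    have "closure (differ Y (T (f n)) (T h)) \<subseteq> cball y s"
      unfolding Tf using n by (intro closure_minimal) auto
    then have "differ X (S (T p)) (S (T q)) \<inter> differ X (S (T (f n))) (S (T h)) = {}"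
      using s by (intro flip.separation T_cfuns pq f h) auto
    then have "differ X p q \<inter> C n = {}"
      by (simp add: S_T pq f h C_def)
    then show ?thesis
      using agree_on_closure[OF pq x(1) x(2) CX] by blast
  qed
  ultimately show ?thesis
    using x y unfolding linked_def by blast
qed

lemma linked_ex_right: "x \<in> X \<Longrightarrow> \<exists>y. linked x y"
  using biseparating_pair.linked_ex_left[OF flip] linked_sym by blast

lemma linked_unique_right: "linked x y \<Longrightarrow> linked x y' \<Longrightarrow> y = y'"
  using biseparating_pair.linked_unique_left[OF flip] linked_sym by blast

section \<open>Continuity of the point map and local dependence\<close>

text \<open>
  Glue the images of the constants \<open>0\<close> and \<open>u\<close> to a function that is the former near \<open>y\<close> and the latter
  outside a ball around \<open>y\<close>.  Its preimage is \<open>0\<close> at \<open>x\<close> and \<open>u\<close> at every point linked to a point outside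
  that ball; by its continuity, such points stay away from \<open>x\<close>.
\<close>

lemma linked_continuous:
  assumes xy: "linked x y" and \<epsilon>: "\<epsilon> > 0"
  shows "\<exists>\<delta>>0. \<forall>x' y'. linked x' y' \<longrightarrow> dist x' x < \<delta> \<longrightarrow> dist y' y < \<epsilon>"
proof -
  obtain u :: 'e where u: "u \<noteq> 0" using nontrivial_domain by auto
  define p :: "'a \<Rightarrow> 'e" where "p = (\<lambda>x\<in>X. 0)"
  define q :: "'a \<Rightarrow> 'e" where "q = (\<lambda>x\<in>X. u)"
  have pq: "p \<in> cfuns X" "q \<in> cfuns X" by (simp_all add: p_def q_def restrict_const_cfuns)
  have X: "x \<in> X" "y \<in> Y" using xy by (auto simp: linked_def)
  define B where "B = Y - ball y \<epsilon>"
  have "closure B \<subseteq> - ball y \<epsilon>" by (rule closure_minimal) (auto simp: B_def)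
  then have yB: "y \<notin> closure B" using \<epsilon> by auto
  then obtain g where g: "g \<in> cfuns Y" "y \<notin> closure (differ Y g (T p))"
    "\<forall>z \<in> Y \<inter> closure B - {y}. z \<notin> closure (differ Y g (T q))"
    using interpolation[OF T_cfuns[OF pq(1)] T_cfuns[OF pq(2)], of "{y}" B] X by auto
  have f: "S g \<in> cfuns X" "T (S g) = g" using g S_cfuns T_S by auto
  have fx: "S g x = 0"
    using xy g(2) f pq X unfolding linked_def by (auto simp: p_def)
  have fx': "S g x' = u" if "linked x' y'" "y' \<in> B" for x' y'
  proof -
    have "y' \<in> Y \<inter> closure B - {y}"
      using that yB closure_subset[of B] by (auto simp: linked_def)
    then show ?thesis
      using g(3) that f pq unfolding linked_def by (auto simp: q_def)
  qed
  obtain \<delta> where \<delta>: "\<delta> > 0" "\<And>x'. \<lbrakk>x' \<in> X; dist x' x < \<delta>\<rbrakk> \<Longrightarrow> dist (S g x') (S g x) < norm u"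
    using cfunsD[OF f(1)] X(1) u unfolding continuous_on_iff by (metis zero_less_norm_iff)
  have "dist y' y < \<epsilon>" if x': "linked x' y'" "dist x' x < \<delta>" for x' y'
  proof (rule ccontr)
    assume "\<not> dist y' y < \<epsilon>"
    then have "y' \<in> B" using x' by (auto simp: B_def linked_def dist_commute)
    then show False
      using fx'[OF x'(1)] \<delta>(2)[of x'] x' fx by (auto simp: linked_def)
  qed
  then show ?thesis using \<delta>(1) by blast
qed

text \<open>
  The definition of \<open>linked\<close> requires agreement on a neighbourhood; agreement at \<open>x\<close> alone
  suffices.  If \<open>x\<close> is approached by points where \<open>f\<close> and \<open>g\<close> differ, some \<open>k\<close> can alternate between \<open>f\<close>
  and \<open>g\<close> along a sequence tending to \<open>x\<close>; then \<open>T k\<close> takes both values \<open>T f y\<close> and \<open>T g y\<close> at \<open>y\<close>.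
\<close>

lemma T_local:
  assumes xy: "linked x y" and f: "f \<in> cfuns X" and g: "g \<in> cfuns X" and eq: "f x = g x"
  shows "T f y = T g y"
proof (cases "x \<in> closure (differ X f g)")
  case False
  then show ?thesis using xy f g by (simp add: linked_def)
next
  case True
  have X: "x \<in> X" and Y: "y \<in> Y" using xy by (auto simp: linked_def)
  have "x islimpt X"
    using True eq by (auto simp: closure_def differ_def intro: islimpt_subset)
  then obtain s where s: "\<And>n::nat. s n \<in> X - {x}" "inj s" "s \<longlonglongrightarrow> x"
    unfolding limpt_sequential_inj by blast
  define A where "A = range (\<lambda>n. s (2 * n))"
  define B where "B = range (\<lambda>n. s (2 * n + 1))"
  have lim: "(\<lambda>n. s (2 * n)) \<longlonglongrightarrow> x" "(\<lambda>n. s (2 * n + 1)) \<longlonglongrightarrow> x"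
    using LIMSEQ_subseq_LIMSEQ[OF s(3), of "\<lambda>n. 2 * n"] LIMSEQ_subseq_LIMSEQ[OF s(3), of "\<lambda>n. 2 * n + 1"]
    by (auto simp: strict_mono_def o_def)
  have clA: "closure A \<subseteq> insert x A"
    using sequence_unique_limpt[OF lim(1)] by (auto simp: closure_def A_def)
  have clB: "closure B \<subseteq> insert x B"
    using sequence_unique_limpt[OF lim(2)] by (auto simp: closure_def B_def)
  have disj: "A \<inter> B = {}"
    using injD[OF s(2)] double_not_eq_Suc_double by (fastforce simp: A_def B_def)
  have xAB: "x \<notin> A" "x \<notin> B" "A \<subseteq> X" "B \<subseteq> X"
    using s(1) by (auto simp: A_def B_def)
  obtain k where k: "k \<in> cfuns X"
    "\<forall>z \<in> X \<inter> closure A - closure B. z \<notin> closure (differ X k f)"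
    "\<forall>z \<in> X \<inter> closure B - closure A. z \<notin> closure (differ X k g)"
    using interpolation[OF f g, of A B] clA clB disj eq by blast
  have 1: "z \<notin> closure (differ X k f)" if "z \<in> A" for z
    using that k(2) xAB disj clB closure_subset by blast
  have 2: "z \<notin> closure (differ X k g)" if "z \<in> B" for z
    using that k(3) xAB disj clA closure_subset by blast
  have along: "T k y = T p y"
    if t: "t \<longlonglongrightarrow> x" "\<And>n::nat. t n \<in> X" "\<And>n. t n \<notin> closure (differ X k p)" and p: "p \<in> cfuns X" for t p
  proof (rule ccontr)
    assume "T k y \<noteq> T p y"
    then obtain r where r: "r > 0" "Y \<inter> ball y r \<subseteq> differ Y (T k) (T p)"
      using differ_open[OF T_cfuns T_cfuns, OF k(1) p, of y] Y by (auto simp: differ_def)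
    obtain \<delta> where \<delta>: "\<delta> > 0" "\<And>x' y'. \<lbrakk>linked x' y'; dist x' x < \<delta>\<rbrakk> \<Longrightarrow> dist y' y < r"
      using linked_continuous[OF xy r(1)] by blast
    obtain n where n: "dist (t n) x < \<delta>"
      using t(1) \<delta>(1) unfolding lim_sequentially by blast
    obtain y' where y': "linked (t n) y'" using linked_ex_right t(2) by blast
    then have "y' \<in> Y \<inter> ball y r"
      using \<delta>(2)[OF y' n] by (auto simp: linked_def dist_commute)
    moreover have "T k y' = T p y'" using y' t(3) k(1) p by (simp add: linked_def)
    ultimately show False using r by (auto simp: differ_def)
  qed
  have "T k y = T f y" "T k y = T g y"
    using along[OF lim(1) _ 1 f] along[OF lim(2) _ 2 g] s(1) by (auto simp: A_def B_def)
  then show ?thesis by simp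
qed

lemma represented:
  assumes "linked x y" "f \<in> cfuns X"
  shows "T f y = T (\<lambda>_\<in>X. f x) y"
  using assms by (intro T_local restrict_const_cfuns) (auto simp: linked_def)

lemma continuous_on_linked:
  assumes "\<And>x. x \<in> X \<Longrightarrow> linked x (\<phi> x)"
  shows "continuous_on X \<phi>"
  unfolding continuous_on_iff using linked_continuous assms by metis

section \<open>The representing functions\<close>

text \<open>
  Continuity in both variables together is reduced to continuity of the image of one function
  \<open>f\<close> with prescribed values \<open>e n\<close> at points \<open>x n\<close> tending to \<open>x0\<close>.  This needs \<open>x n \<noteq> x0\<close>.
  A bad pair \<open>(y0, e)\<close> is therefore replaced by a pair \<open>(y', e)\<close> with \<open>y' \<noteq> y0\<close>, at the cost of half
  of \<open>\<epsilon>\<close>; here it matters that \<open>y0\<close> is not isolated.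
\<close>

lemma evaluation_continuous:
  assumes xy: "linked x0 y0" and lim: "y0 islimpt Y"
  shows "continuous (at (y0, e0) within Y \<times> UNIV) (\<lambda>(y, e). T (\<lambda>_\<in>X. e) y)"
proof (rule ccontr)
  define \<Phi> where "\<Phi> y e = T (\<lambda>_\<in>X. e) y" for y e
  assume "\<not> ?thesis"
  then have "\<not> continuous (at (y0, e0) within Y \<times> UNIV) (\<lambda>(y, e). \<Phi> y e)"
    by (simp add: \<Phi>_def)
  then obtain \<epsilon> where \<epsilon>: "\<epsilon> > 0" and bad: "\<And>\<delta>. \<delta> > 0 \<Longrightarrow>
      \<exists>y e. y \<in> Y \<and> dist (y, e) (y0, e0) < \<delta> \<and> dist (\<Phi> y e) (\<Phi> y0 e0) \<ge> \<epsilon>"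
    unfolding continuous_within_eps_delta by (force simp: not_less)
  have x0: "x0 \<in> X" and y0: "y0 \<in> Y" using xy by (auto simp: linked_def)
  interpret flip: biseparating_pair Y X S T by (rule flip)
  define P where "P x e \<longleftrightarrow> (\<exists>y. linked x y \<and> dist (\<Phi> y e) (\<Phi> y0 e0) \<ge> \<epsilon> / 2)" for x e
  have "\<exists>f \<in> cfuns X. f x0 = e0 \<and> (\<forall>\<delta>>0. \<exists>x\<in>X. dist x x0 < \<delta> \<and> P x (f x))"
  proof (rule exists_function_through_sequence)
    fix \<delta> :: real assume "\<delta> > 0"
    then obtain \<delta>' where \<delta>': "\<delta>' > 0" "\<And>x' y'. \<lbrakk>linked x' y'; dist y' y0 < \<delta>'\<rbrakk> \<Longrightarrow> dist x' x0 < \<delta>"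
      using flip.linked_continuous[of y0 x0 \<delta>] xy linked_sym by blast
    obtain y e where ye: "y \<in> Y" "dist (y, e) (y0, e0) < min \<delta> \<delta>'" "dist (\<Phi> y e) (\<Phi> y0 e0) \<ge> \<epsilon>"
      using bad[of "min \<delta> \<delta>'"] \<open>\<delta> > 0\<close> \<delta>'(1) by auto
    have dist: "dist y y0 < \<delta>'" "dist e e0 < \<delta>"
      using ye(2) dist_fst_le[of "(y, e)" "(y0, e0)"] dist_snd_le[of "(y, e)" "(y0, e0)"] by auto
    have "\<exists>y'. y' \<in> Y \<and> y' \<noteq> y0 \<and> dist y' y0 < \<delta>' \<and> dist (\<Phi> y' e) (\<Phi> y e) < \<epsilon> / 2"
    proof (cases "y = y0")
      case True
      have "continuous_on Y (\<lambda>y. \<Phi> y e)"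
        unfolding \<Phi>_def by (intro cfunsD T_cfuns restrict_const_cfuns)
      then obtain \<eta> where \<eta>: "\<eta> > 0" "\<And>y'. \<lbrakk>y' \<in> Y; dist y' y0 < \<eta>\<rbrakk> \<Longrightarrow> dist (\<Phi> y' e) (\<Phi> y0 e) < \<epsilon> / 2"
        unfolding continuous_on_iff using y0 \<epsilon> by (metis half_gt_zero)
      obtain y' where "y' \<in> Y" "y' \<noteq> y0" "dist y' y0 < min \<eta> \<delta>'"
        using lim \<eta>(1) \<delta>'(1) unfolding islimpt_approachable by (metis min_less_iff_conj)
      then show ?thesis using \<eta> True by auto
    qed (use ye dist \<epsilon> in auto)
    then obtain y' where y': "y' \<in> Y" "y' \<noteq> y0" "dist y' y0 < \<delta>'" "dist (\<Phi> y' e) (\<Phi> y e) < \<epsilon> / 2" by blast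
    obtain x' where x': "linked x' y'" using linked_ex_left y' by blast
    have "x' \<noteq> x0" using x' xy y' linked_unique_right by blast
    moreover have "dist (\<Phi> y' e) (\<Phi> y0 e0) \<ge> \<epsilon> / 2"
      using ye(3) y'(4) dist_triangle[of "\<Phi> y e" "\<Phi> y0 e0" "\<Phi> y' e"] by (simp add: dist_commute)
    ultimately show "\<exists>x e. x \<in> X \<and> x \<noteq> x0 \<and> dist x x0 < \<delta> \<and> dist e e0 < \<delta> \<and> P x e"
      using x' \<delta>'(2)[OF x' y'(3)] dist unfolding P_def linked_def by blast
  qed (rule x0)
  then obtain f where f: "f \<in> cfuns X" "f x0 = e0"
    and fP: "\<And>\<delta>. \<delta> > 0 \<Longrightarrow> \<exists>x\<in>X. dist x x0 < \<delta> \<and> P x (f x)" by blast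
  obtain \<eta> where \<eta>: "\<eta> > 0" "\<And>y. \<lbrakk>y \<in> Y; dist y y0 < \<eta>\<rbrakk> \<Longrightarrow> dist (T f y) (T f y0) < \<epsilon> / 2"
    using cfunsD[OF T_cfuns[OF f(1)]] y0 \<epsilon> unfolding continuous_on_iff by (metis half_gt_zero)
  obtain \<delta> where \<delta>: "\<delta> > 0" "\<And>x' y'. \<lbrakk>linked x' y'; dist x' x0 < \<delta>\<rbrakk> \<Longrightarrow> dist y' y0 < \<eta>"
    using linked_continuous[OF xy \<eta>(1)] by blast
  obtain x y where "linked x y" "dist x x0 < \<delta>" "dist (\<Phi> y (f x)) (\<Phi> y0 e0) \<ge> \<epsilon> / 2"
    using fP[OF \<delta>(1)] by (auto simp: P_def)
  then show False
    using \<eta>(2)[of y] \<delta>(2)[of x y] represented[of x y f] represented[OF xy f(1)] f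
    by (auto simp: \<Phi>_def linked_def not_less)
qed

lemma inverse_evaluation:
  assumes "linked x y"
  shows "S (\<lambda>_\<in>Y. T (\<lambda>_\<in>X. u) y) x = u"
proof -
  interpret flip: biseparating_pair Y X S T by (rule flip)
  have "S (\<lambda>_\<in>Y. T (\<lambda>_\<in>X. u) y) x = S (T (\<lambda>_\<in>X. u)) x"
    using assms linked_sym
    by (intro flip.T_local[of y x] restrict_const_cfuns T_cfuns) (auto simp: linked_def)
  then show ?thesis
    using assms by (simp add: S_T restrict_const_cfuns linked_def)
qed

end

section \<open>The characterisation\<close>

lemma biseparating_pair_inv_into:
  fixes T :: "('a::metric_space \<Rightarrow> 'e::real_normed_vector) \<Rightarrow> ('b::metric_space \<Rightarrow> 'f::real_normed_vector)"
  assumes "\<exists>u::'e. u \<noteq> 0" "\<exists>v::'f. v \<noteq> 0" and T: "biseparating X Y T"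
  shows "biseparating_pair X Y T (inv_into (cfuns X) T)"
proof
  have bij: "bij_betw T (cfuns X) (cfuns Y)" using T by (simp add: biseparating_def)
  show "T f \<in> cfuns Y" if "f \<in> cfuns X" for f
    using bij that by (rule bij_betw_apply)
  show "inv_into (cfuns X) T g \<in> cfuns X" if "g \<in> cfuns Y" for g
    using bij that by (metis bij_betw_def inv_into_into)
  show "inv_into (cfuns X) T (T f) = f" if "f \<in> cfuns X" for f
    using bij that by (rule bij_betw_inv_into_left)
  show "T (inv_into (cfuns X) T g) = g" if "g \<in> cfuns Y" for g
    using bij that by (rule bij_betw_inv_into_right)
  show "perp Y (T h) (T f) (T g) \<longleftrightarrow> perp X h f g"
    if "f \<in> cfuns X" "g \<in> cfuns X" "h \<in> cfuns X" for f g h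
    using T that by (simp add: biseparating_def)
qed (use assms in auto)

lemma biseparating_if_represented:
  fixes X :: "'a::metric_space set" and Y :: "'b::metric_space set"
    and T :: "('a \<Rightarrow> 'e::real_normed_vector) \<Rightarrow> ('b \<Rightarrow> 'f::real_normed_vector)"
  assumes T: "T \<in> cfuns X \<rightarrow> cfuns Y"
    and hom: "homeomorphism X Y \<phi> \<psi>"
    and rep: "\<And>f y. \<lbrakk>f \<in> cfuns X; y \<in> Y\<rbrakk> \<Longrightarrow> T f y = \<Phi> (y, f (\<psi> y))"
    and inv1: "\<And>x u. x \<in> X \<Longrightarrow> \<Psi> (x, \<Phi> (\<phi> x, u)) = u"
    and inv2: "\<And>x v. x \<in> X \<Longrightarrow> \<Phi> (\<phi> x, \<Psi> (x, v)) = v"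
    and cont: "\<And>x v. x \<in> accumulation_points X \<Longrightarrow> continuous (at (x, v) within X \<times> UNIV) \<Psi>"
  shows "biseparating X Y T"
proof -
  have \<phi>: "\<phi> x \<in> Y" "\<psi> (\<phi> x) = x" if "x \<in> X" for x
    using hom that by (auto simp: homeomorphism_def)
  have \<psi>: "\<psi> y \<in> X" "\<phi> (\<psi> y) = y" if "y \<in> Y" for y
    using hom that by (auto simp: homeomorphism_def)
  have eq_iff: "T f y = T g y \<longleftrightarrow> f (\<psi> y) = g (\<psi> y)" if "f \<in> cfuns X" "g \<in> cfuns X" "y \<in> Y" for f g y
    using that rep inv1[OF \<psi>(1)] \<psi> by metis
  have "inj_on T (cfuns X)"
  proof (rule inj_onI)
    fix f g assume fg: "f \<in> cfuns X" "g \<in> cfuns X" "T f = T g"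
    show "f = g"
      using eq_iff[OF fg(1,2) \<phi>(1)] fg \<phi> by (intro cfuns_eqI[OF fg(1,2)]) simp
  qed
  moreover have "g \<in> T ` cfuns X" if g: "g \<in> cfuns Y" for g
  proof -
    let ?f = "\<lambda>x\<in>X. \<Psi> (x, g (\<phi> x))"
    have "continuous (at x within X) (\<lambda>x. \<Psi> (x, g (\<phi> x)))" if x: "x \<in> X" for x
    proof (cases "x islimpt X")
      case True
      then have "continuous (at (x, g (\<phi> x)) within X \<times> UNIV) \<Psi>"
        using x cont by (simp add: accumulation_points_def)
      then have "continuous (at (x, g (\<phi> x)) within (\<lambda>x. (x, g (\<phi> x))) ` X) \<Psi>"
        by (rule continuous_within_subset) auto
      moreover have "continuous_on X (\<lambda>x. g (\<phi> x))"
        using hom cfunsD[OF g] by (auto simp: homeomorphism_def intro: continuous_on_compose2)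
      then have "continuous (at x within X) (\<lambda>x. (x, g (\<phi> x)))"
        using x by (intro continuous_intros) (auto simp: continuous_on_eq_continuous_within)
      ultimately show ?thesis
        using continuous_within_compose[of x X "\<lambda>x. (x, g (\<phi> x))" \<Psi>] by (simp add: o_def)
    next
      case False
      then show ?thesis
        by (simp add: continuous_within trivial_limit_within[THEN iffD2])
    qed
    then have f: "?f \<in> cfuns X"
      by (intro restrict_cfuns) (simp add: continuous_on_eq_continuous_within)
    have "T ?f = g"
      using T f by (intro cfuns_eqI[OF _ g]) (auto simp: rep \<psi> inv2[OF \<psi>(1), simplified \<psi>(2)] Pi_iff,
        metis \<psi> inv2)
    then show ?thesis using f by (metis image_eqI)
  qed
  ultimately have "bij_betw T (cfuns X) (cfuns Y)"
    using T by (auto simp: bij_betw_def)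
  moreover have "perp X h f g \<longleftrightarrow> perp Y (T h) (T f) (T g)"
    if "f \<in> cfuns X" "g \<in> cfuns X" "h \<in> cfuns X" for f g h
  proof -
    have "Y = \<phi> ` X" using hom by (simp add: homeomorphism_def)
    then show ?thesis
      using that eq_iff \<phi> by (auto simp: perp_iff_differ differ_def disjoint_iff)
  qed
  ultimately show ?thesis by (simp add: biseparating_def)
qed

theorem theorem6p3:
  fixes X :: "'a::metric_space set"
    and Y :: "'b::metric_space set"
    and T :: "('a \<Rightarrow> 'e::real_normed_vector) \<Rightarrow> ('b \<Rightarrow> 'f::real_normed_vector)"
  assumes "\<exists>u::'e. u \<noteq> 0"
    and "\<exists>v::'f. v \<noteq> 0"
    and "T \<in> cfuns X \<rightarrow> cfuns Y"
  shows "biseparating X Y T \<longleftrightarrow>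
    (\<exists>(\<phi> :: 'a \<Rightarrow> 'b) (\<phi>inv :: 'b \<Rightarrow> 'a) (\<Phi> :: 'b \<times> 'e \<Rightarrow> 'f) (\<Psi> :: 'a \<times> 'f \<Rightarrow> 'e).
      homeomorphism X Y \<phi> \<phi>inv \<and>
      (\<forall>f\<in>cfuns X. \<forall>y\<in>Y. T f y = \<Phi> (y, f (\<phi>inv y))) \<and>
      (\<forall>x\<in>X. \<forall>y\<in>Y. \<phi> x = y \<longrightarrow>
        (\<forall>u. \<Psi> (x, \<Phi> (y, u)) = u) \<and> (\<forall>v. \<Phi> (y, \<Psi> (x, v)) = v)) \<and>
      (\<forall>p \<in> accumulation_points Y \<times> UNIV. continuous (at p within Y \<times> UNIV) \<Phi>) \<and>
      (\<forall>q \<in> accumulation_points X \<times> UNIV. continuous (at q within X \<times> UNIV) \<Psi>))"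
proof
  assume bisep: "biseparating X Y T"
  let ?S = "inv_into (cfuns X) T"
  interpret biseparating_pair X Y T ?S
    using assms(1,2) bisep by (rule biseparating_pair_inv_into)
  interpret flip: biseparating_pair Y X ?S T by (rule flip)
  obtain \<phi> where \<phi>: "\<And>x. x \<in> X \<Longrightarrow> linked x (\<phi> x)" using linked_ex_right by metis
  obtain \<psi> where \<psi>: "\<And>y. y \<in> Y \<Longrightarrow> linked (\<psi> y) y" using linked_ex_left by metis
  have in_Y: "\<phi> x \<in> Y" if "x \<in> X" for x using \<phi>[OF that] by (simp add: linked_def)
  have in_X: "\<psi> y \<in> X" if "y \<in> Y" for y using \<psi>[OF that] by (simp add: linked_def)
  have "\<psi> (\<phi> x) = x" if "x \<in> X" for x
    using linked_unique_left \<phi>[OF that] \<psi>[OF in_Y[OF that]] by blast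
  moreover have "\<phi> (\<psi> y) = y" if "y \<in> Y" for y
    using linked_unique_right \<psi>[OF that] \<phi>[OF in_X[OF that]] by blast
  moreover have "continuous_on X \<phi>" using \<phi> by (rule continuous_on_linked)
  moreover have "continuous_on Y \<psi>"
    using \<psi> linked_sym by (intro flip.continuous_on_linked) blast
  ultimately have hom: "homeomorphism X Y \<phi> \<psi>"
    using in_X in_Y by (intro homeomorphismI) auto
  let ?\<Phi> = "\<lambda>(y, u). T (\<lambda>_\<in>X. u) y"
  let ?\<Psi> = "\<lambda>(x, v). ?S (\<lambda>_\<in>Y. v) x"
  show "\<exists>(\<phi> :: 'a \<Rightarrow> 'b) (\<phi>inv :: 'b \<Rightarrow> 'a) (\<Phi> :: 'b \<times> 'e \<Rightarrow> 'f) (\<Psi> :: 'a \<times> 'f \<Rightarrow> 'e).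
      homeomorphism X Y \<phi> \<phi>inv \<and>
      (\<forall>f\<in>cfuns X. \<forall>y\<in>Y. T f y = \<Phi> (y, f (\<phi>inv y))) \<and>
      (\<forall>x\<in>X. \<forall>y\<in>Y. \<phi> x = y \<longrightarrow>
        (\<forall>u. \<Psi> (x, \<Phi> (y, u)) = u) \<and> (\<forall>v. \<Phi> (y, \<Psi> (x, v)) = v)) \<and>
      (\<forall>p \<in> accumulation_points Y \<times> UNIV. continuous (at p within Y \<times> UNIV) \<Phi>) \<and>
      (\<forall>q \<in> accumulation_points X \<times> UNIV. continuous (at q within X \<times> UNIV) \<Psi>)"
  proof (intro exI[of _ \<phi>] exI[of _ \<psi>] exI[of _ ?\<Phi>] exI[of _ ?\<Psi>] conjI)
    show "homeomorphism X Y \<phi> \<psi>" by (rule hom)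
    show "\<forall>f\<in>cfuns X. \<forall>y\<in>Y. T f y = ?\<Phi> (y, f (\<psi> y))"
      using represented[OF \<psi>] by simp
    show "\<forall>x\<in>X. \<forall>y\<in>Y. \<phi> x = y \<longrightarrow>
        (\<forall>u. ?\<Psi> (x, ?\<Phi> (y, u)) = u) \<and> (\<forall>v. ?\<Phi> (y, ?\<Psi> (x, v)) = v)"
      using inverse_evaluation[OF \<phi>] flip.inverse_evaluation \<phi> linked_sym by auto
    show "\<forall>p \<in> accumulation_points Y \<times> UNIV. continuous (at p within Y \<times> UNIV) ?\<Phi>"
      using evaluation_continuous[OF \<psi>] by (auto simp: accumulation_points_def)
    show "\<forall>q \<in> accumulation_points X \<times> UNIV. continuous (at q within X \<times> UNIV) ?\<Psi>"
      using flip.evaluation_continuous \<phi> linked_sym by (auto simp: accumulation_points_def)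
  qed
next
  assume "\<exists>(\<phi> :: 'a \<Rightarrow> 'b) (\<phi>inv :: 'b \<Rightarrow> 'a) (\<Phi> :: 'b \<times> 'e \<Rightarrow> 'f) (\<Psi> :: 'a \<times> 'f \<Rightarrow> 'e).
      homeomorphism X Y \<phi> \<phi>inv \<and>
      (\<forall>f\<in>cfuns X. \<forall>y\<in>Y. T f y = \<Phi> (y, f (\<phi>inv y))) \<and>
      (\<forall>x\<in>X. \<forall>y\<in>Y. \<phi> x = y \<longrightarrow>
        (\<forall>u. \<Psi> (x, \<Phi> (y, u)) = u) \<and> (\<forall>v. \<Phi> (y, \<Psi> (x, v)) = v)) \<and>
      (\<forall>p \<in> accumulation_points Y \<times> UNIV. continuous (at p within Y \<times> UNIV) \<Phi>) \<and>
      (\<forall>q \<in> accumulation_points X \<times> UNIV. continuous (at q within X \<times> UNIV) \<Psi>)"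
  then obtain \<phi> \<psi> \<Phi> \<Psi> where *: "homeomorphism X Y \<phi> \<psi> \<and>
      (\<forall>f\<in>cfuns X. \<forall>y\<in>Y. T f y = \<Phi> (y, f (\<psi> y))) \<and>
      (\<forall>x\<in>X. \<forall>y\<in>Y. \<phi> x = y \<longrightarrow>
        (\<forall>u. \<Psi> (x, \<Phi> (y, u)) = u) \<and> (\<forall>v. \<Phi> (y, \<Psi> (x, v)) = v)) \<and>
      (\<forall>p \<in> accumulation_points Y \<times> UNIV. continuous (at p within Y \<times> UNIV) \<Phi>) \<and>
      (\<forall>q \<in> accumulation_points X \<times> UNIV. continuous (at q within X \<times> UNIV) \<Psi>)"
    by (elim exE) (rule that)
  then have hom: "homeomorphism X Y \<phi> \<psi>"
    and rep: "\<And>f y. \<lbrakk>f \<in> cfuns X; y \<in> Y\<rbrakk> \<Longrightarrow> T f y = \<Phi> (y, f (\<psi> y))"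
    and inv: "\<And>x. \<lbrakk>x \<in> X; \<phi> x \<in> Y\<rbrakk> \<Longrightarrow>
      (\<forall>u. \<Psi> (x, \<Phi> (\<phi> x, u)) = u) \<and> (\<forall>v. \<Phi> (\<phi> x, \<Psi> (x, v)) = v)"
    and cont: "\<And>x v. x \<in> accumulation_points X \<Longrightarrow> continuous (at (x, v) within X \<times> UNIV) \<Psi>"
    by blast+
  have "\<phi> x \<in> Y" if "x \<in> X" for x
    using hom that by (auto simp: homeomorphism_def)
  then show "biseparating X Y T"
    using inv by (intro biseparating_if_represented[OF assms(3) hom rep _ _ cont]) auto
qed

end
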